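(* Let $(\Omega,\mathcal{F})$ be a measurable space and let $E\subset\Omega\times\Omega$ be a measurable equivalence relation. Then, for all $\mu,\nu\in\mathcal{P}(\mathcal{F})$, there is $\nu_0\in\mathcal{P}(\mathcal{F})$ such that $$\nu_0=\nu\text{ on }\mathcal{G}_0\quad\text{and}\quad\min_{P\in\Gamma(\mu,\nu_0)}(1-P(E))=\|\mu-\nu\|_{\mathcal{G}_0},$$ where $$\mathcal{G}_0=\{A\in\mathcal{F}:\ 1_A(x)=1_A(y)\text{ for all }(x,y)\in E\}.$$ (Here "$\min$" asserts that the infimum is achieved.)
   Context: $\mathcal{P}(\mathcal{F})$ is the set of all probability measures on $\mathcal{F}$. A measurable equivalence relation is a set $E\in\mathcal{F}\otimes\mathcal{F}$ such that the relation $x\sim y\Leftrightarrow(x,y)\in E$ is reflexive, symmetric and transitive on $\Omega$. For $\alpha,\beta\in\mathcal{P}(\mathcal{F})$, $\Gamma(\alpha,\beta)$ is the set of all ($\sigma$-additive) probability measures $P$ on $\mathcal{F}\otimes\mathcal{F}$ with marginals $\alpha$ and $\beta$, i.e. $P(A\times\Omega)=\alpha(A)$ and $P(\Omega\times A)=\beta(A)$ for all $A\in\mathcal{F}$. For a sub-$\sigma$-field $\mathcal{G}\subset\mathcal{F}$, $\|\mu-\nu\|_{\mathcal{G}}=\sup_{A\in\mathcal{G}}|\mu(A)-\nu(A)|$. *)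

theory Defs
  imports "HOL-Probability.Probability"
begin

text \<open>
  A measurable space is represented by a measure \<open>M\<close> of which only \<open>space M\<close> and \<open>sets M\<close>
  are used. The set of all probability measures on its \<open>\<sigma>\<close>-field is
  \<open>space (prob_algebra M)\<close>, that is, all \<open>N\<close> with \<open>prob_space N\<close> and \<open>sets N = sets M\<close>.
\<close>

definition measurable_equivalence :: "'a measure \<Rightarrow> ('a \<times> 'a) set \<Rightarrow> bool" where
  "measurable_equivalence M E \<longleftrightarrow> E \<in> sets (M \<Otimes>\<^sub>M M) \<and> equiv (space M) E"

definition couplings :: "'a measure \<Rightarrow> 'a measure \<Rightarrow> 'a measure \<Rightarrow> ('a \<times> 'a) measure set" where
  "couplings M \<alpha> \<beta> =
    {P \<in> space (prob_algebra (M \<Otimes>\<^sub>M M)).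
      \<forall>A\<in>sets M. measure P (A \<times> space M) = measure \<alpha> A \<and> measure P (space M \<times> A) = measure \<beta> A}"

definition invariant_sets :: "'a measure \<Rightarrow> ('a \<times> 'a) set \<Rightarrow> 'a set set" where
  "invariant_sets M E =
    {A \<in> sets M. \<forall>(x, y)\<in>E. (indicator A x :: real) = indicator A y}"

definition tv_dist :: "'a set set \<Rightarrow> 'a measure \<Rightarrow> 'a measure \<Rightarrow> real" where
  "tv_dist G \<mu> \<nu> = (SUP A\<in>G. \<bar>measure \<mu> A - measure \<nu> A\<bar>)"

end

theory Submission
  imports Defs
begin

text \<open>
  Let \<open>D\<close> be a Hahn set for \<open>\<mu> - \<nu>\<close> on \<open>\<G>\<^sub>0\<close>, and let \<open>\<kappa>\<close> be the minimum of \<open>\<mu>\<close> and \<open>\<nu>\<close> on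
  \<open>\<G>\<^sub>0\<close>, that is, \<open>\<nu>\<close> on \<open>D\<close> and \<open>\<mu>\<close> off \<open>D\<close>. Since the Radon-Nikodym densities of \<open>\<kappa>\<close> are
  \<open>\<G>\<^sub>0\<close>-measurable functions with values in \<open>[0, 1]\<close>, they also split the measures on the whole
  \<open>\<sigma>\<close>-field: \<open>\<mu> = \<mu>\<^sub>1 + \<mu>\<^sub>2\<close> and \<open>\<nu> = \<nu>\<^sub>1 + \<nu>\<^sub>2\<close> with \<open>\<mu>\<^sub>1 = \<nu>\<^sub>1 = \<kappa>\<close> on \<open>\<G>\<^sub>0\<close>. Put
  \<open>\<nu>\<^sub>0 = \<mu>\<^sub>1 + \<nu>\<^sub>2\<close>. Coupling \<open>\<mu>\<^sub>1\<close> with itself along the diagonal, which lies in \<open>E\<close>, and \<open>\<mu>\<^sub>2\<close>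
  with \<open>\<nu>\<^sub>2\<close> independently leaves at most the mass \<open>\<mu>\<^sub>2(\<Omega>) = \<mu>(D) - \<nu>(D)\<close> outside \<open>E\<close>. No coupling
  does better, as \<open>A \<times> \<Omega>\<close> and \<open>\<Omega> \<times> A\<close> agree on \<open>E\<close> for \<open>A \<in> \<G>\<^sub>0\<close>.
\<close>

section \<open>Sums and splittings of measures along a sub-sigma-field\<close>

definition add_measure :: "'a measure \<Rightarrow> 'a measure \<Rightarrow> 'a measure" where
  "add_measure M N = measure_of (space M) (sets M) (\<lambda>A. emeasure M A + emeasure N A)"

lemma sets_add_measure [simp, measurable_cong]: "sets (add_measure M N) = sets M"
  by (simp add: add_measure_def)

lemma space_add_measure [simp]: "space (add_measure M N) = space M"
  by (simp add: add_measure_def)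

lemma emeasure_add_measure:
  assumes "sets N = sets M" "A \<in> sets M"
  shows "emeasure (add_measure M N) A = emeasure M A + emeasure N A"
  unfolding add_measure_def
proof (rule emeasure_measure_of_sigma)
  show "countably_additive (sets M) (\<lambda>A. emeasure M A + emeasure N A)"
    using assms(1) by (auto simp: countably_additive_def suminf_add[symmetric] suminf_emeasure)
qed (auto simp: assms sets.sigma_algebra_axioms positive_def)

text \<open>The density of \<open>K\<close> is taken relative to the restriction of \<open>N\<close>
  to \<open>G\<close>. It is \<open>G\<close>-measurable and, after truncation, has values in
  [0, 1], so it and its complement serve as densities over all of \<open>N\<close>.\<close>

lemma dominated_on_subalgebra_split:
  assumes "finite_measure N" and sub: "subalgebra N G"
    and "finite_measure K" and sK: "sets K = sets G"
    and le: "\<And>A. A \<in> sets G \<Longrightarrow> emeasure K A \<le> emeasure N A"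
  obtains N1 N2 where "sets N1 = sets N" "sets N2 = sets N"
    "\<And>A. A \<in> sets N \<Longrightarrow> emeasure N1 A + emeasure N2 A = emeasure N A"
    "\<And>A. A \<in> sets G \<Longrightarrow> emeasure N1 A = emeasure K A"
proof -
  define R where "R = restr_to_subalg N G"
  have sR: "sets R = sets G"
    unfolding R_def by (rule sets_restr_to_subalg[OF sub])
  have eR: "emeasure R A = emeasure N A" if "A \<in> sets G" for A
    unfolding R_def using emeasure_restr_to_subalg[OF sub that] .
  interpret K: finite_measure K by fact
  interpret R: finite_measure R
    unfolding R_def by (rule finite_measure_restr_to_subalg[OF sub assms(1)])
  have "absolutely_continuous R K"
    unfolding absolutely_continuous_def
  proof
    fix A assume "A \<in> null_sets R"
    then show "A \<in> null_sets K"
      using le[of A] eR[of A] sR sK by (auto simp: null_sets_def)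
  qed
  then obtain f where f[measurable]: "f \<in> borel_measurable R" and fK: "density R f = K"
    using R.Radon_Nikodym[of K] sK sR by auto
  \<comment> \<open>The bound \<open>f x \<le> 1\<close> will hold only almost everywhere;
    truncating makes \<open>h x + (1 - h x) = 1\<close> true at every point in
    \<open>ennreal\<close>.\<close>
  define h where "h x = min (f x) 1" for x
  have h[measurable]: "h \<in> borel_measurable R"
    unfolding h_def by measurable
  have h_G: "h \<in> borel_measurable G"
    using h sR by (simp cong: measurable_cong_sets)
  have h_N[measurable]: "h \<in> borel_measurable N"
    by (rule measurable_from_subalg[OF sub h_G])
  \<comment> \<open>On \<open>B\<close> the density exceeds 1, yet its integral there is
    \<open>K B \<le> R B\<close>. As \<open>R\<close> is finite, a non-null \<open>B\<close> would
    make that integral strictly larger.\<close>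
  have "AE x in R. f x \<le> 1"
  proof -
    define B where "B = {x \<in> space R. 1 < f x}"
    have B[measurable]: "B \<in> sets R"
      unfolding B_def by measurable
    have "(\<integral>\<^sup>+x. f x * indicator B x \<partial>R) = emeasure K B"
      by (simp add: fK[symmetric] emeasure_density)
    also have "\<dots> \<le> (\<integral>\<^sup>+x. indicator B x \<partial>R)"
      using le[of B] eR[of B] B sR by simp
    finally have le: "(\<integral>\<^sup>+x. f x * indicator B x \<partial>R) \<le> integral\<^sup>N R (indicator B)" .
    have "AE x in R. f x * indicator B x \<le> indicator B x"
    proof (rule ccontr)
      assume "\<not> ?thesis"
      then have "integral\<^sup>N R (indicator B) < (\<integral>\<^sup>+x. f x * indicator B x \<partial>R)"
        by (intro nn_integral_less) (auto simp: B_def split: split_indicator)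
      with le show False by simp
    qed
    with AE_space show ?thesis
      by eventually_elim (auto simp: B_def split: split_indicator_asm)
  qed
  then have h_f: "AE x in R. h x = f x"
    by eventually_elim (simp add: h_def)
  show thesis
  proof
    show "emeasure (density N h) A + emeasure (density N (\<lambda>x. 1 - h x)) A = emeasure N A"
      if [measurable]: "A \<in> sets N" for A
    proof -
      have "emeasure (density N h) A + emeasure (density N (\<lambda>x. 1 - h x)) A
          = (\<integral>\<^sup>+x. h x * indicator A x + (1 - h x) * indicator A x \<partial>N)"
        by (simp add: emeasure_density nn_integral_add)
      also have "\<dots> = (\<integral>\<^sup>+x. indicator A x \<partial>N)"
        by (intro nn_integral_cong) (auto simp: h_def add_diff_inverse_ennreal split: split_indicator)
      finally show ?thesis by simp
    qed
    show "emeasure (density N h) A = emeasure K A" if A: "A \<in> sets G" for A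
    proof -
      have AN[measurable]: "A \<in> sets N" and AR[measurable]: "A \<in> sets R"
        using A sub sR by (auto simp: subalgebra_def)
      have "emeasure (density N h) A = (\<integral>\<^sup>+x. h x * indicator A x \<partial>N)"
        by (simp add: emeasure_density)
      also have "\<dots> = (\<integral>\<^sup>+x. h x * indicator A x \<partial>R)"
        unfolding R_def using h_G A by (intro nn_integral_subalgebra2[OF sub, symmetric]) simp
      also have "\<dots> = (\<integral>\<^sup>+x. f x * indicator A x \<partial>R)"
        using h_f by (intro nn_integral_cong_AE) auto
      also have "\<dots> = emeasure K A"
        by (simp add: fK[symmetric] emeasure_density)
      finally show ?thesis .
    qed
  qed simp_all
qed

text \<open>On either side of a Hahn set the smaller of the two measures is known, so gluing these
  pieces gives a measure below both. The total mass is recorded because it determines the mass left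
  over in the splittings.\<close>

lemma common_part_on_subalgebra:
  assumes "finite_measure \<mu>" "finite_measure \<nu>" and sub: "subalgebra \<mu> G" "subalgebra \<nu> G"
  obtains K D where "finite_measure K" "sets K = sets G" "D \<in> sets G"
    "\<And>A. A \<in> sets G \<Longrightarrow> emeasure K A \<le> emeasure \<mu> A"
    "\<And>A. A \<in> sets G \<Longrightarrow> emeasure K A \<le> emeasure \<nu> A"
    "emeasure K (space G) = emeasure \<nu> D + emeasure \<mu> (space G - D)"
proof -
  define a where "a = restr_to_subalg \<mu> G"
  define b where "b = restr_to_subalg \<nu> G"
  have s[measurable_cong, simp]: "sets a = sets G" "sets b = sets G"
    unfolding a_def b_def using sub by (auto simp: sets_restr_to_subalg)
  have e: "emeasure a A = emeasure \<mu> A" "emeasure b A = emeasure \<nu> A" if "A \<in> sets G" for A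
    unfolding a_def b_def using emeasure_restr_to_subalg sub that by blast+
  have "finite_measure a" "finite_measure b"
    unfolding a_def b_def using assms by (auto intro: finite_measure_restr_to_subalg)
  interpret a: finite_measure a by fact
  interpret b: finite_measure b by fact
  obtain D where D: "D \<in> sets G"
    and le: "\<And>A. A \<in> sets G \<Longrightarrow> A \<subseteq> D \<Longrightarrow> emeasure b A \<le> emeasure a A"
    and ge: "\<And>A. A \<in> sets G \<Longrightarrow> A \<inter> D = {} \<Longrightarrow> emeasure a A \<le> emeasure b A"
    using finite_unsigned_Hahn_decomposition[OF \<open>finite_measure a\<close> \<open>finite_measure b\<close>] by auto
  \<comment> \<open>Indicator densities cut the measures down to \<open>D\<close> and its complement
    without changing the space, so the pieces can be added.\<close>
  define K where "K = add_measure (density b (indicator D)) (density a (indicator (space G - D)))"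
  have K: "emeasure K A = emeasure b (A \<inter> D) + emeasure a (A - D)" if A: "A \<in> sets G" for A
  proof -
    have "A \<inter> (space G - D) = A - D"
      using sets.sets_into_space[OF A] by auto
    then show ?thesis
      using A D unfolding K_def
      by (simp add: emeasure_add_measure emeasure_density nn_integral_indicator
          flip: indicator_inter_arith) (simp add: Int_commute)
  qed
  have split: "emeasure N A = emeasure N (A \<inter> D) + emeasure N (A - D)"
    if "A \<in> sets G" "sets N = sets G" for A and N :: "'a measure"
    using that D by (subst plus_emeasure) (auto intro!: arg_cong[where f = "emeasure N"])
  show thesis
  proof
    show sK: "sets K = sets G"
      by (simp add: K_def)
    show "D \<in> sets G" by fact
    show Ka: "emeasure K A \<le> emeasure \<mu> A" if A: "A \<in> sets G" for A
    proof -
      have "emeasure K A \<le> emeasure a A"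
        using le[of "A \<inter> D"] A D by (simp add: K split[of A a] add_right_mono)
      then show ?thesis using e A by simp
    qed
    show "emeasure K A \<le> emeasure \<nu> A" if A: "A \<in> sets G" for A
    proof -
      have "emeasure K A \<le> emeasure b A"
        using ge[of "A - D"] A D by (simp add: K split[of A b] add_left_mono Diff_Int_distrib2)
      then show ?thesis using e A by simp
    qed
    have sp: "space K = space G"
      using sK by (rule sets_eq_imp_space_eq)
    show "finite_measure K"
      using Ka[of "space G"] a.finite_emeasure_space e[of "space G"] sets_eq_imp_space_eq[of a G]
      by (intro finite_measureI) (auto simp: sp top_unique)
    show "emeasure K (space G) = emeasure \<nu> D + emeasure \<mu> (space G - D)"
      using K[of "space G"] D e sets.sets_into_space[OF D] by (simp add: Int_absorb1)
  qed
qed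

section \<open>Invariant sets and the lower bound for couplings\<close>

lemma invariant_sets_eq:
  "invariant_sets M E = {A \<in> sets M. \<forall>(x, y)\<in>E. x \<in> A \<longleftrightarrow> y \<in> A}"
proof -
  have "(indicator A x :: real) = indicator A y \<longleftrightarrow> (x \<in> A \<longleftrightarrow> y \<in> A)" for A and x y :: 'a
    by (simp add: indicator_def)
  then show ?thesis
    by (simp add: invariant_sets_def)
qed

text \<open>This turns the invariant sets into a sub-sigma-field in the form of a measure. The
  assumption on \<open>E\<close> serves complements: both points of a related pair must lie in the
  space.\<close>

lemma sets_sigma_invariant_sets:
  assumes "E \<subseteq> space M \<times> space M"
  shows "sets (sigma (space M) (invariant_sets M E)) = invariant_sets M E"
proof -
  have "sigma_algebra (space M) (invariant_sets M E)"
    unfolding sigma_algebra_iff2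
  proof (intro conjI ballI allI impI)
    show "invariant_sets M E \<subseteq> Pow (space M)"
      by (auto simp: invariant_sets_def dest: sets.sets_into_space)
    show "{} \<in> invariant_sets M E"
      by (simp add: invariant_sets_def)
    show "space M - A \<in> invariant_sets M E" if "A \<in> invariant_sets M E" for A
      using that assms by (fastforce simp: invariant_sets_eq)
    show "(\<Union>i. A i) \<in> invariant_sets M E"
      if A: "range A \<subseteq> invariant_sets M E" for A :: "nat \<Rightarrow> 'a set"
    proof -
      have "A i \<in> invariant_sets M E" for i
        using A by auto
      then show ?thesis
        by (fastforce simp: invariant_sets_eq)
    qed
  qed
  then show ?thesis
    by (rule sigma_algebra.sets_measure_of_eq)
qed

text \<open>The parts of the two cylinders inside \<open>E\<close> cancel. The parts outside have
  masses between 0 and \<open>1 - measure P E\<close>, so their difference obeys the same bound,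
  with no factor 2.\<close>

lemma coupling_dist_le:
  assumes P: "P \<in> couplings M \<alpha> \<beta>" and E: "E \<in> sets (M \<Otimes>\<^sub>M M)" and A: "A \<in> invariant_sets M E"
  shows "\<bar>measure \<alpha> A - measure \<beta> A\<bar> \<le> 1 - measure P E"
proof -
  have sP[simp]: "sets P = sets (M \<Otimes>\<^sub>M M)" and "prob_space P"
    using P by (auto simp: couplings_def space_prob_algebra)
  interpret P: prob_space P by fact
  have AM: "A \<in> sets M"
    using A by (simp add: invariant_sets_def)
  let ?X = "A \<times> space M" and ?Y = "space M \<times> A"
  have X: "?X \<in> sets P" "?Y \<in> sets P" "E \<in> sets P" "space P - E \<in> sets P"
    using AM E sets.compl_sets[of E P] by (auto simp del: sets.compl_sets simp: pair_measureI)
  have XY: "?X \<inter> E = ?Y \<inter> E"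
    using A sets.sets_into_space[OF E]
    by (fastforce simp: invariant_sets_eq space_pair_measure)
  have "measure \<alpha> A = P.prob ?X" "measure \<beta> A = P.prob ?Y"
    using P AM by (auto simp: couplings_def)
  moreover have "P.prob ?X = P.prob (?X \<inter> E) + P.prob (?X - E)" "P.prob ?Y = P.prob (?Y \<inter> E) + P.prob (?Y - E)"
    using X by (auto simp: P.finite_measure_Diff' Int_commute)
  moreover have "P.prob (Z - E) \<le> 1 - P.prob E" if "Z \<in> sets P" for Z
    using that X sets.sets_into_space[OF that]
    by (subst P.prob_compl[symmetric]) (auto intro!: P.finite_measure_mono)
  note this[OF X(1)] this[OF X(2)]
  ultimately have "measure \<alpha> A - measure \<beta> A = P.prob (?X - E) - P.prob (?Y - E)"
    "P.prob (?X - E) \<le> 1 - P.prob E" "P.prob (?Y - E) \<le> 1 - P.prob E"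
    by (simp_all add: XY)
  then show ?thesis
    using measure_nonneg[of P "?X - E"] measure_nonneg[of P "?Y - E"] by linarith
qed

section \<open>Construction of the modified measure and of an optimal coupling\<close>

theorem theorem5:
  fixes M :: "'a measure" and E :: "('a \<times> 'a) set" and \<mu> \<nu> :: "'a measure"
  assumes "measurable_equivalence M E"
    and "\<mu> \<in> space (prob_algebra M)"
    and "\<nu> \<in> space (prob_algebra M)"
  shows "\<exists>\<nu>\<^sub>0 \<in> space (prob_algebra M).
    (\<forall>A \<in> invariant_sets M E. measure \<nu>\<^sub>0 A = measure \<nu> A) \<and>
    (\<exists>P. is_arg_min (\<lambda>P. 1 - measure P E) (\<lambda>P. P \<in> couplings M \<mu> \<nu>\<^sub>0) P \<and>
         1 - measure P E = tv_dist (invariant_sets M E) \<mu> \<nu>)"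
proof -
  have E[measurable]: "E \<in> sets (M \<Otimes>\<^sub>M M)" and diag: "\<And>x. x \<in> space M \<Longrightarrow> (x, x) \<in> E"
    using assms(1) by (auto simp: measurable_equivalence_def equiv_def refl_on_def)
  have s[measurable_cong, simp]: "sets \<mu> = sets M" "sets \<nu> = sets M"
    and "prob_space \<mu>" "prob_space \<nu>"
    using assms by (auto simp: space_prob_algebra)
  interpret \<mu>: prob_space \<mu> by fact
  interpret \<nu>: prob_space \<nu> by fact
  have sp[simp]: "space \<mu> = space M" "space \<nu> = space M"
    using s[THEN sets_eq_imp_space_eq] by simp_all
  define G where "G = sigma (space M) (invariant_sets M E)"
  have sG: "sets G = invariant_sets M E"
    unfolding G_def using sets.sets_into_space[OF E]
    by (intro sets_sigma_invariant_sets) (simp add: space_pair_measure)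
  have spG[simp]: "space G = space M"
    by (simp add: G_def space_measure_of_conv)
  have G_M: "A \<in> sets M" if "A \<in> sets G" for A
    using that sG by (simp add: invariant_sets_def)
  have sub: "subalgebra \<mu> G" "subalgebra \<nu> G"
    using G_M by (auto simp: subalgebra_def)
  obtain K D where K: "finite_measure K" "sets K = sets G" and D: "D \<in> sets G"
    and K\<mu>: "\<And>A. A \<in> sets G \<Longrightarrow> emeasure K A \<le> emeasure \<mu> A"
    and K\<nu>: "\<And>A. A \<in> sets G \<Longrightarrow> emeasure K A \<le> emeasure \<nu> A"
    and K_space: "emeasure K (space G) = emeasure \<nu> D + emeasure \<mu> (space G - D)"
    using common_part_on_subalgebra[OF \<mu>.finite_measure_axioms \<nu>.finite_measure_axioms sub] by metis
  obtain \<mu>1 \<mu>2 where s\<mu>[measurable_cong, simp]: "sets \<mu>1 = sets M" "sets \<mu>2 = sets M"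
    and \<mu>_split: "\<And>A. A \<in> sets M \<Longrightarrow> emeasure \<mu>1 A + emeasure \<mu>2 A = emeasure \<mu> A"
    and \<mu>1_K: "\<And>A. A \<in> sets G \<Longrightarrow> emeasure \<mu>1 A = emeasure K A"
    using dominated_on_subalgebra_split[OF \<mu>.finite_measure_axioms sub(1) K K\<mu>] s by metis
  obtain \<nu>1 \<nu>2 where s\<nu>[measurable_cong, simp]: "sets \<nu>1 = sets M" "sets \<nu>2 = sets M"
    and \<nu>_split: "\<And>A. A \<in> sets M \<Longrightarrow> emeasure \<nu>1 A + emeasure \<nu>2 A = emeasure \<nu> A"
    and \<nu>1_K: "\<And>A. A \<in> sets G \<Longrightarrow> emeasure \<nu>1 A = emeasure K A"
    using dominated_on_subalgebra_split[OF \<nu>.finite_measure_axioms sub(2) K K\<nu>] s by metis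
  have sp'[simp]: "space \<mu>1 = space M" "space \<mu>2 = space M" "space \<nu>1 = space M" "space \<nu>2 = space M"
    using s\<mu>[THEN sets_eq_imp_space_eq] s\<nu>[THEN sets_eq_imp_space_eq] by simp_all

  \<comment> \<open>This is the common mass of the leftovers \<open>\<mu>2\<close> and
    \<open>\<nu>2\<close>, and in the end the distance itself.\<close>
  define c where "c = measure \<mu> D - measure \<nu> D"
  have K_top: "emeasure K (space M) = ennreal (1 - c)"
  proof -
    have "measure \<nu> D + measure \<mu> (space M - D) = 1 - c"
      using \<mu>.prob_compl[of D] G_M[OF D] by (simp add: c_def)
    then show ?thesis
      using K_space by (simp add: \<mu>.emeasure_eq_measure \<nu>.emeasure_eq_measure flip: ennreal_plus)
  qed
  have c: "0 \<le> c" "c \<le> 1"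
  proof -
    show "c \<le> 1"
      unfolding c_def using \<mu>.prob_le_1[of D] measure_nonneg[of \<nu> D] by linarith
    have "ennreal (1 - c) \<le> 1"
      using K\<mu>[of "space G"] K_top \<mu>.emeasure_space_1 sets.top[of G] by simp
    then show "0 \<le> c"
      by (simp add: ennreal_le_1)
  qed
  have cancel: "x = ennreal c" if "ennreal (1 - c) + x = 1" for x
  proof -
    have "ennreal (1 - c) + x = ennreal (1 - c) + ennreal c"
      using that c by (simp flip: ennreal_plus)
    then show ?thesis
      by (simp add: ennreal_add_left_cancel)
  qed
  have \<mu>2_top: "emeasure \<mu>2 (space M) = ennreal c"
    using \<mu>_split[of "space M"] \<mu>1_K[of "space G"] K_top \<mu>.emeasure_space_1 sets.top[of G]
    by (intro cancel) simp
  have \<nu>2_top: "emeasure \<nu>2 (space M) = ennreal c"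
    using \<nu>_split[of "space M"] \<nu>1_K[of "space G"] K_top \<nu>.emeasure_space_1 sets.top[of G]
    by (intro cancel) simp
  interpret \<nu>2: finite_measure \<nu>2
    using \<nu>2_top by (intro finite_measureI) simp

  define \<nu>0 where "\<nu>0 = add_measure \<mu>1 \<nu>2"
  have s\<nu>0[simp]: "sets \<nu>0 = sets M"
    by (simp add: \<nu>0_def)
  have \<nu>0: "emeasure \<nu>0 A = emeasure \<mu>1 A + emeasure \<nu>2 A" if "A \<in> sets M" for A
    unfolding \<nu>0_def using that by (simp add: emeasure_add_measure)
  have \<nu>0_G: "emeasure \<nu>0 A = emeasure \<nu> A" if A: "A \<in> sets G" for A
    using \<nu>0[OF G_M[OF A]] \<nu>_split[OF G_M[OF A]] \<mu>1_K[OF A] \<nu>1_K[OF A] by simp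
  have prob\<nu>0: "prob_space \<nu>0"
    using \<nu>0_G[of "space G"] \<nu>.emeasure_space_1 sets.top[of G]
    by (intro prob_spaceI) (simp add: \<nu>0_def)

  \<comment> \<open>For \<open>c = 0\<close> the factor \<open>1 / c\<close> is \<open>0\<close>, and both \<open>\<mu>2\<close> and \<open>\<nu>2\<close> vanish.\<close>
  define P where "P = add_measure (distr \<mu>1 (M \<Otimes>\<^sub>M M) (\<lambda>x. (x, x)))
    (scale_measure (ennreal (1 / c)) (\<mu>2 \<Otimes>\<^sub>M \<nu>2))"
  have s2: "sets (\<mu>2 \<Otimes>\<^sub>M \<nu>2) = sets (M \<Otimes>\<^sub>M M)"
    by (intro sets_pair_measure_cong) auto
  have sP[simp]: "sets P = sets (M \<Otimes>\<^sub>M M)"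
    by (simp add: P_def)
  have P: "emeasure P X = emeasure \<mu>1 {x \<in> space M. (x, x) \<in> X}
      + ennreal (1 / c) * emeasure (\<mu>2 \<Otimes>\<^sub>M \<nu>2) X" if X: "X \<in> sets (M \<Otimes>\<^sub>M M)" for X
    unfolding P_def using X s2
    by (subst emeasure_add_measure) (auto simp: emeasure_distr vimage_def Int_def conj_commute)
  \<comment> \<open>The marginals of the product are \<open>\<mu>2\<close> and \<open>\<nu>2\<close>
    multiplied by \<open>c\<close>, which the factor \<open>1 / c\<close> undoes. If
    \<open>c = 0\<close>, the bound forces \<open>x = 0\<close>.\<close>
  have rescale: "ennreal (1 / c) * (x * ennreal c) = x" if "x \<le> ennreal c" for x
  proof (cases "c = 0")
    case False
    then have "ennreal (1 / c) * ennreal c = 1"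
      using c by (simp flip: ennreal_mult)
    then show ?thesis
      by (metis mult.assoc mult.commute mult_1)
  qed (use that in simp)
  have PX: "emeasure P (A \<times> space M) = emeasure \<mu> A"
    and PY: "emeasure P (space M \<times> A) = emeasure \<nu>0 A" if A: "A \<in> sets M" for A
  proof -
    have *: "{x \<in> space M. x \<in> A} = A"
      using sets.sets_into_space[OF A] by auto
    have le: "emeasure \<mu>2 A \<le> ennreal c" "emeasure \<nu>2 A \<le> ennreal c"
      using emeasure_space[of \<mu>2 A] emeasure_space[of \<nu>2 A] by (auto simp: \<mu>2_top \<nu>2_top)
    show "emeasure P (A \<times> space M) = emeasure \<mu> A"
      using A rescale[OF le(1)]
      by (simp add: P * \<nu>2.emeasure_pair_measure_Times \<nu>2_top \<mu>_split cong: conj_cong)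
    show "emeasure P (space M \<times> A) = emeasure \<nu>0 A"
      using A rescale[OF le(2)]
      by (simp add: P * \<nu>2.emeasure_pair_measure_Times \<mu>2_top \<nu>0 mult.commute cong: conj_cong)
  qed
  interpret P: prob_space P
    using PX[of "space M"] \<mu>.emeasure_space_1
    by (intro prob_spaceI) (simp add: P_def space_pair_measure)
  have P_coupling: "P \<in> couplings M \<mu> \<nu>0"
    using PX PY P.prob_space_axioms
    by (auto simp: couplings_def space_prob_algebra measure_def)
  \<comment> \<open>By reflexivity the diagonal part puts its whole mass on \<open>E\<close>;
    whatever the product part adds is dropped.\<close>
  have "ennreal (1 - c) \<le> emeasure P E"
  proof -
    have "{x \<in> space M. (x, x) \<in> E} = space M"
      using diag by auto
    then show ?thesis
      using P[OF E] \<mu>1_K[of "space G"] K_top sets.top[of G] by simp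
  qed
  then have PE: "1 - measure P E \<le> c"
    using c by (simp add: P.emeasure_eq_measure)

  have tv_ge: "c \<le> tv_dist (invariant_sets M E) \<mu> \<nu>"
  proof -
    have "\<bar>measure \<mu> A - measure \<nu> A\<bar> \<le> 1" for A
      using \<mu>.prob_le_1[of A] \<nu>.prob_le_1[of A] measure_nonneg[of \<mu> A] measure_nonneg[of \<nu> A]
      by linarith
    then have "bdd_above ((\<lambda>A. \<bar>measure \<mu> A - measure \<nu> A\<bar>) ` invariant_sets M E)"
      by (auto intro!: bdd_aboveI2)
    then have "\<bar>measure \<mu> D - measure \<nu> D\<bar> \<le> tv_dist (invariant_sets M E) \<mu> \<nu>"
      unfolding tv_dist_def using D sG by (intro cSUP_upper) auto
    then show ?thesis
      by (simp add: c_def)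
  qed
  \<comment> \<open>Since \<open>\<nu>0\<close> and \<open>\<nu>\<close> agree on invariant sets,
    the bound for couplings of \<open>\<mu>\<close> and \<open>\<nu>0\<close> applies. Taking
    \<open>Q = P\<close> closes the circle of inequalities through \<open>c\<close>; general
    \<open>Q\<close> gives minimality.\<close>
  have tv_le: "tv_dist (invariant_sets M E) \<mu> \<nu> \<le> 1 - measure Q E" if Q: "Q \<in> couplings M \<mu> \<nu>0" for Q
    unfolding tv_dist_def
  proof (rule cSUP_least)
    show "invariant_sets M E \<noteq> {}"
      using D sG by auto
    show "\<bar>measure \<mu> A - measure \<nu> A\<bar> \<le> 1 - measure Q E" if A: "A \<in> invariant_sets M E" for A
      using coupling_dist_le[OF Q E A] \<nu>0_G[of A] A sG by (simp add: measure_def)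
  qed
  have eq: "1 - measure P E = tv_dist (invariant_sets M E) \<mu> \<nu>"
    using tv_le[OF P_coupling] tv_ge PE by simp
  show ?thesis
  proof (intro bexI conjI exI ballI)
    show "\<nu>0 \<in> space (prob_algebra M)"
      using prob\<nu>0 by (simp add: space_prob_algebra)
    show "measure \<nu>0 A = measure \<nu> A" if "A \<in> invariant_sets M E" for A
      using \<nu>0_G[of A] that sG by (simp add: measure_def)
    show "is_arg_min (\<lambda>P. 1 - measure P E) (\<lambda>P. P \<in> couplings M \<mu> \<nu>0) P"
      using P_coupling tv_le eq by (force simp: is_arg_min_def not_less)
  qed (fact eq)
qed

end
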